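(* Let $\mathsf{Val}$ be a value function (on finite or on infinite sequences) that is present focused and suffix monotonic. Then a nondeterministic $\mathsf{Val}$ automaton is history deterministic if and only if it is determinizable by pruning.
   Context: A nondeterministic quantitative automaton is $\mathcal{A}=(\Sigma,Q,\iota,\delta)$ with finite nonempty alphabet $\Sigma$, finite nonempty state set $Q$, initial state $\iota$, and $\delta:Q\times\Sigma\to 2^{\mathbb{Q}\times Q}$ with finite nonempty values; $(x,q')\in\delta(q,a)$ gives a transition $q\xrightarrow{a:x}q'$. It is deterministic if all $\delta(q,a)$ are singletons. A $\mathsf{Val}$ automaton is one equipped with a value function $\mathsf{Val}:\mathbb{Q}^*\to\mathbb{R}$ (finite words) or $\mathsf{Val}:\mathbb{Q}^\omega\to\mathbb{R}$ (infinite words). A run on a word $w$ is a sequence $\pi$ of consecutive transitions from $\iota$ (or from a specified state) over the letters of $w$; $\mathsf{Val}(\pi)$ is $\mathsf{Val}$ of its weight sequence; $\mathcal{A}(w)$ is the supremum of $\mathsf{Val}(\pi)$ over runs $\pi$ on $w$ from $\iota$. Automata are equivalent if they give the same value to each word. **History determinism (nondeterministic case).** In (Eve's) letter game on $\mathcal{A}$, starting from $\iota$, in each round Adam picks a letter $\sigma\in\Sigma$ and Eve picks a transition over $\sigma$ from the current state; this produces an infinite word $w$ and a run $\pi$. For infinite words, Eve wins the play if $\mathsf{Val}(\pi)\ge\mathcal{A}(w)$; for finite words, if $\mathsf{Val}(\pi[0..i])\ge\mathcal{A}(w[0..i])$ for all $i$. $\mathcal{A}$ is history deterministic if Eve has a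 winning strategy (depending on the history of the play). **Determinizability by pruning.** $\mathcal{A}$ is determinizable by pruning if there is a deterministic $\mathsf{Val}$ automaton equivalent to $\mathcal{A}$ obtained from $\mathcal{A}$ by removing some states and transitions. **Cautious strategies.** In the letter game on $\mathcal{A}$, a move $t=q\xrightarrow{\sigma:x}q'$ of Eve, played after a run $\rho$ ending in state $q$, is non-cautious if for some word $w$ there is a run $\pi'$ from $q$ over $\sigma w$ such that $\mathsf{Val}(\rho\pi')$ is strictly greater than $\mathsf{Val}(\rho\pi)$ for every run $\pi$ from $q$ over $\sigma w$ starting with $t$. A strategy is cautious if it makes no non-cautious moves. **Present focused.** $\mathsf{Val}$ is present focused if for all $\mathsf{Val}$ automata $\mathcal{A}$, every cautious strategy of Eve in the letter game on $\mathcal{A}$ is a winning strategy in that game. **Suffix monotonic.** $\mathsf{Val}$ is suffix monotonic if for every finite set $S\subset\mathbb{Q}$, every $\alpha\in S^*$ and all $\beta,\beta'\in S^*\cup S^\omega$ (in the domain of $\mathsf{Val}$), $\mathsf{Val}(\beta)\ge\mathsf{Val}(\beta')$ if and only if $\mathsf{Val}(\alpha\beta)\ge\mathsf{Val}(\alpha\beta')$. *)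

theory Defs
  imports "HOL-Library.Stream" "HOL-Library.Extended_Real"
begin

text \<open>Finite and infinite sequences; they serve as words, runs and weight sequences.\<close>

datatype 'b fseq = Fin "'b list" | Inf "'b stream"

primrec prepend :: "'b list \<Rightarrow> 'b fseq \<Rightarrow> 'b fseq"  (infixr "\<odot>" 65) where
  "xs \<odot> Fin ys = Fin (xs @ ys)"
| "xs \<odot> Inf ys = Inf (xs @- ys)"

datatype value_fun = FinVal "rat list \<Rightarrow> real" | InfVal "rat stream \<Rightarrow> real"

text \<open>The sequences over \<open>S\<close> of the kind on which the value function operates.\<close>

primrec seqs :: "value_fun \<Rightarrow> 'b set \<Rightarrow> 'b fseq set" where
  "seqs (FinVal f) S = Fin ` lists S"
| "seqs (InfVal f) S = Inf ` streams S"

text \<open>The value is unspecified on sequences of the wrong kind, where it is never used.\<close>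

fun val :: "value_fun \<Rightarrow> rat fseq \<Rightarrow> real" where
  "val (FinVal f) (Fin xs) = f xs"
| "val (InfVal f) (Inf xs) = f xs"
| "val _ _ = undefined"

record ('a, 'q) qaut =
  alphabet :: "'a set"
  states :: "'q set"
  initial :: 'q
  delta :: "'q \<Rightarrow> 'a \<Rightarrow> (rat \<times> 'q) set"

text \<open>The function \<^const>\<open>delta\<close> is only meaningful on states and letters of the automaton.\<close>

definition automaton :: "('a, 'q) qaut \<Rightarrow> bool" where
  "automaton A \<longleftrightarrow>
     finite (alphabet A) \<and> alphabet A \<noteq> {} \<and>
     finite (states A) \<and> initial A \<in> states A \<and>
     (\<forall>q\<in>states A. \<forall>a\<in>alphabet A.
        finite (delta A q a) \<and> delta A q a \<noteq> {} \<and> delta A q a \<subseteq> UNIV \<times> states A)"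

definition deterministic :: "('a, 'q) qaut \<Rightarrow> bool" where
  "deterministic A \<longleftrightarrow> (\<forall>q\<in>states A. \<forall>a\<in>alphabet A. is_singleton (delta A q a))"

datatype ('a, 'q) transition =
  Transition (src: 'q) (letter: 'a) (weight: rat) (tgt: 'q)

definition is_transition :: "('a, 'q) qaut \<Rightarrow> ('a, 'q) transition \<Rightarrow> bool" where
  "is_transition A t \<longleftrightarrow>
     src t \<in> states A \<and> letter t \<in> alphabet A \<and>
     (weight t, tgt t) \<in> delta A (src t) (letter t)"

primrec fin_run :: "('a, 'q) qaut \<Rightarrow> 'q \<Rightarrow> ('a, 'q) transition list \<Rightarrow> bool" where
  "fin_run A q [] \<longleftrightarrow> True"
| "fin_run A q (t # \<pi>) \<longleftrightarrow> is_transition A t \<and> src t = q \<and> fin_run A (tgt t) \<pi>"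

definition inf_run :: "('a, 'q) qaut \<Rightarrow> 'q \<Rightarrow> ('a, 'q) transition stream \<Rightarrow> bool" where
  "inf_run A q \<pi> \<longleftrightarrow>
     src (shd \<pi>) = q \<and>
     (\<forall>i. is_transition A (\<pi> !! i) \<and> tgt (\<pi> !! i) = src (\<pi> !! Suc i))"

primrec run :: "('a, 'q) qaut \<Rightarrow> 'q \<Rightarrow> ('a, 'q) transition fseq \<Rightarrow> bool" where
  "run A q (Fin \<pi>) \<longleftrightarrow> fin_run A q \<pi>"
| "run A q (Inf \<pi>) \<longleftrightarrow> inf_run A q \<pi>"

definition runs_on ::
  "('a, 'q) qaut \<Rightarrow> 'q \<Rightarrow> 'a fseq \<Rightarrow> ('a, 'q) transition fseq set" where
  "runs_on A q w = {\<pi>. run A q \<pi> \<and> map_fseq letter \<pi> = w}"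

definition run_value :: "value_fun \<Rightarrow> ('a, 'q) transition fseq \<Rightarrow> real" where
  "run_value V \<pi> = val V (map_fseq weight \<pi>)"

text \<open>The supremum is taken in the extended reals, because the values of the infinitely many
  runs on an infinite word need not be bounded for an arbitrary value function.\<close>

definition aut_value :: "value_fun \<Rightarrow> ('a, 'q) qaut \<Rightarrow> 'a fseq \<Rightarrow> ereal" where
  "aut_value V A w = (SUP \<pi>\<in>runs_on A (initial A) w. ereal (run_value V \<pi>))"

definition equivalent :: "value_fun \<Rightarrow> ('a, 'q) qaut \<Rightarrow> ('a, 'q) qaut \<Rightarrow> bool" where
  "equivalent V A B \<longleftrightarrow>
     alphabet A = alphabet B \<and>
     (\<forall>w\<in>seqs V (alphabet A). aut_value V A w = aut_value V B w)"

definition determinizable_by_pruning :: "value_fun \<Rightarrow> ('a, 'q) qaut \<Rightarrow> bool" where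
  "determinizable_by_pruning V A \<longleftrightarrow>
     (\<exists>B. automaton B \<and> deterministic B \<and> equivalent V A B \<and>
          alphabet B = alphabet A \<and> states B \<subseteq> states A \<and> initial B = initial A \<and>
          (\<forall>q\<in>states B. \<forall>a\<in>alphabet B. delta B q a \<subseteq> delta A q a))"

text \<open>A strategy of Eve maps the history, namely the run built so far (whose transitions carry
  the letters played by Adam), and Adam's current letter to her next transition.\<close>

type_synonym ('a, 'q) strategy = "('a, 'q) transition list \<Rightarrow> 'a \<Rightarrow> ('a, 'q) transition"

definition end_state :: "('a, 'q) qaut \<Rightarrow> ('a, 'q) transition list \<Rightarrow> 'q" where
  "end_state A \<rho> = (if \<rho> = [] then initial A else tgt (last \<rho>))"

definition is_strategy :: "('a, 'q) qaut \<Rightarrow> ('a, 'q) strategy \<Rightarrow> bool" where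
  "is_strategy A s \<longleftrightarrow>
     (\<forall>\<rho> \<sigma>. fin_run A (initial A) \<rho> \<longrightarrow> \<sigma> \<in> alphabet A \<longrightarrow>
        is_transition A (s \<rho> \<sigma>) \<and> src (s \<rho> \<sigma>) = end_state A \<rho> \<and> letter (s \<rho> \<sigma>) = \<sigma>)"

text \<open>The finite histories and the infinite plays in which Eve follows the strategy \<open>s\<close>; Adam's
  letters are those carried by the transitions.\<close>

definition history :: "('a, 'q) qaut \<Rightarrow> ('a, 'q) strategy \<Rightarrow> ('a, 'q) transition list \<Rightarrow> bool" where
  "history A s \<rho> \<longleftrightarrow>
     fin_run A (initial A) \<rho> \<and> (\<forall>i<length \<rho>. \<rho> ! i = s (take i \<rho>) (letter (\<rho> ! i)))"

definition play :: "('a, 'q) qaut \<Rightarrow> ('a, 'q) strategy \<Rightarrow> ('a, 'q) transition stream \<Rightarrow> bool" where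
  "play A s \<pi> \<longleftrightarrow>
     inf_run A (initial A) \<pi> \<and> (\<forall>i. \<pi> !! i = s (stake i \<pi>) (letter (\<pi> !! i)))"

definition dominates :: "value_fun \<Rightarrow> ('a, 'q) qaut \<Rightarrow> ('a, 'q) transition fseq \<Rightarrow> bool" where
  "dominates V A \<pi> \<longleftrightarrow> ereal (run_value V \<pi>) \<ge> aut_value V A (map_fseq letter \<pi>)"

primrec eve_wins :: "value_fun \<Rightarrow> ('a, 'q) qaut \<Rightarrow> ('a, 'q) transition stream \<Rightarrow> bool" where
  "eve_wins (FinVal f) A \<pi> \<longleftrightarrow> (\<forall>i. dominates (FinVal f) A (Fin (stake (Suc i) \<pi>)))"
| "eve_wins (InfVal f) A \<pi> \<longleftrightarrow> dominates (InfVal f) A (Inf \<pi>)"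

definition winning :: "value_fun \<Rightarrow> ('a, 'q) qaut \<Rightarrow> ('a, 'q) strategy \<Rightarrow> bool" where
  "winning V A s \<longleftrightarrow> (\<forall>\<pi>. play A s \<pi> \<longrightarrow> eve_wins V A \<pi>)"

definition history_deterministic :: "value_fun \<Rightarrow> ('a, 'q) qaut \<Rightarrow> bool" where
  "history_deterministic V A \<longleftrightarrow> (\<exists>s. is_strategy A s \<and> winning V A s)"

definition non_cautious_move ::
  "value_fun \<Rightarrow> ('a, 'q) qaut \<Rightarrow> ('a, 'q) transition list \<Rightarrow> ('a, 'q) transition \<Rightarrow> bool" where
  "non_cautious_move V A \<rho> t \<longleftrightarrow>
     (\<exists>w\<in>seqs V (alphabet A). \<exists>\<pi>'\<in>runs_on A (src t) ([letter t] \<odot> w).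
        \<forall>\<pi>\<in>runs_on A (src t) ([letter t] \<odot> w).
          (\<exists>\<pi>\<^sub>0. \<pi> = [t] \<odot> \<pi>\<^sub>0) \<longrightarrow> run_value V (\<rho> \<odot> \<pi>') > run_value V (\<rho> \<odot> \<pi>))"

definition cautious :: "value_fun \<Rightarrow> ('a, 'q) qaut \<Rightarrow> ('a, 'q) strategy \<Rightarrow> bool" where
  "cautious V A s \<longleftrightarrow>
     (\<forall>\<rho> \<sigma>. history A s \<rho> \<longrightarrow> \<sigma> \<in> alphabet A \<longrightarrow> \<not> non_cautious_move V A \<rho> (s \<rho> \<sigma>))"

text \<open>HOL cannot quantify over all types of letters and states inside a definition. Alphabets and
  state sets are finite, so every automaton is isomorphic to one whose letters and states are
  natural numbers, and quantifying over these covers all automata.\<close>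

definition present_focused :: "value_fun \<Rightarrow> bool" where
  "present_focused V \<longleftrightarrow>
     (\<forall>(A :: (nat, nat) qaut) s.
        automaton A \<longrightarrow> is_strategy A s \<longrightarrow> cautious V A s \<longrightarrow> winning V A s)"

definition suffix_monotonic :: "value_fun \<Rightarrow> bool" where
  "suffix_monotonic V \<longleftrightarrow>
     (\<forall>S. finite S \<longrightarrow>
        (\<forall>\<alpha>\<in>lists S. \<forall>\<beta>\<in>seqs V S. \<forall>\<beta>'\<in>seqs V S.
           val V \<beta> \<ge> val V \<beta>' \<longleftrightarrow> val V (\<alpha> \<odot> \<beta>) \<ge> val V (\<alpha> \<odot> \<beta>')))"

end

theory Submission
  imports Defs "HOL-Library.Countable_Set"
begin

text \<open>A winning strategy is cautious, since a non-cautious move lets Adam play a word whose value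
  Eve can no longer reach. By suffix monotonicity, whether a move is cautious depends only on the
  transition and not on the run leading to it. Hence keeping, at each state that a winning
  strategy reaches, the moves it makes after one fixed history ending there yields a deterministic
  subautomaton with cautious transitions only. Playing inside it is a cautious strategy, which is
  winning because the value function is present focused; so the subautomaton is equivalent to the
  whole automaton. Conversely, following an equivalent deterministic subautomaton wins the
  letter game.\<close>

section \<open>Runs\<close>

lemma prepend_Nil [simp]: "[] \<odot> \<pi> = \<pi>"
  by (cases \<pi>) auto

lemma prepend_append: "(xs @ ys) \<odot> \<pi> = xs \<odot> ys \<odot> \<pi>"
  by (cases \<pi>) auto

lemma map_fseq_prepend: "map_fseq f (xs \<odot> \<pi>) = map f xs \<odot> map_fseq f \<pi>"
  by (cases \<pi>) auto

lemma map_fseq_ident: "(\<And>x. x \<in> set_fseq \<pi> \<Longrightarrow> f x = x) \<Longrightarrow> map_fseq f \<pi> = \<pi>"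
  using fseq.map_cong0[of \<pi> f id] by (simp add: fseq.map_id)

text \<open>Separates the kind of a sequence, finite or infinite as \<open>V\<close> demands, from
  the condition on its entries. Maps preserve the kind, so only the entries remain to be checked
  later.\<close>

lemma seqs_iff: "\<pi> \<in> seqs V S \<longleftrightarrow> \<pi> \<in> seqs V UNIV \<and> set_fseq \<pi> \<subseteq> S"
proof (cases V)
  case (FinVal f)
  show ?thesis
    unfolding FinVal by (auto simp: lists_eq_set)
next
  case (InfVal f)
  show ?thesis
    unfolding InfVal by (auto simp: streams_iff_sset)
qed

lemma seqs_UNIV_map: "map_fseq f \<pi> \<in> seqs V UNIV \<longleftrightarrow> \<pi> \<in> seqs V UNIV"
  by (cases V; cases \<pi>) auto

lemma map_fseq_in_seqs: "\<pi> \<in> seqs V S \<Longrightarrow> f ` S \<subseteq> T \<Longrightarrow> map_fseq f \<pi> \<in> seqs V T"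
  using seqs_iff[of \<pi> V S] seqs_iff[of "map_fseq f \<pi>" V T]
  by (auto simp: seqs_UNIV_map fseq.set_map)

lemma fin_run_append:
  "fin_run A q (xs @ ys) \<longleftrightarrow>
     fin_run A q xs \<and> fin_run A (if xs = [] then q else tgt (last xs)) ys"
  by (induction xs arbitrary: q) auto

lemma fin_run_transition: "fin_run A q xs \<Longrightarrow> t \<in> set xs \<Longrightarrow> is_transition A t"
  by (induction xs arbitrary: q) auto

lemma inf_run_Cons:
  "inf_run A q (t ## \<pi>) \<longleftrightarrow> is_transition A t \<and> src t = q \<and> inf_run A (tgt t) \<pi>"
proof -
  have "(\<forall>i. P i) \<longleftrightarrow> P 0 \<and> (\<forall>i. P (Suc i))" for P :: "nat \<Rightarrow> bool"
    by (metis not0_implies_Suc)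
  from this[of "\<lambda>i. is_transition A ((t ## \<pi>) !! i) \<and> tgt ((t ## \<pi>) !! i) = src ((t ## \<pi>) !! Suc i)"]
  show ?thesis
    unfolding inf_run_def by auto
qed

text \<open>Being a run constrains only adjacent transitions, so finite prefixes detect it. This
  carries facts about finite runs over to infinite ones.\<close>

lemma inf_run_iff_stake: "inf_run A q \<pi> \<longleftrightarrow> (\<forall>n. fin_run A q (stake n \<pi>))"
proof
  show "\<forall>n. fin_run A q (stake n \<pi>)" if "inf_run A q \<pi>"
  proof
    fix n
    show "fin_run A q (stake n \<pi>)"
      using that
    proof (induction n arbitrary: q \<pi>)
      case (Suc n)
      then show ?case
        using inf_run_Cons[of A q "shd \<pi>" "stl \<pi>"] by simp
    qed simp
  qed
next
  assume runs: "\<forall>n. fin_run A q (stake n \<pi>)"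
  have "is_transition A (\<pi> !! i) \<and> tgt (\<pi> !! i) = src (\<pi> !! Suc i)" for i
  proof -
    \<comment> \<open>A prefix of length \<open>i + 2\<close> is the shortest one that shows the
      link between transitions \<open>i\<close> and \<open>i + 1\<close>.\<close>
    have "stake (Suc (Suc i)) \<pi> = stake i \<pi> @ [\<pi> !! i, \<pi> !! Suc i]"
      by (simp only: stake_Suc append_assoc append_Cons append_Nil)
    then show ?thesis
      using runs[rule_format, of "Suc (Suc i)"] by (auto simp: fin_run_append)
  qed
  moreover have "src (shd \<pi>) = q"
    using runs[rule_format, of 1] by simp
  ultimately show "inf_run A q \<pi>"
    unfolding inf_run_def by blast
qed

lemma run_prepend:
  "run A q (xs \<odot> \<pi>) \<longleftrightarrow> fin_run A q xs \<and> run A (if xs = [] then q else tgt (last xs)) \<pi>"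
proof (cases \<pi>)
  case (Inf p)
  then show ?thesis
    by (induction xs arbitrary: q) (auto simp: inf_run_Cons)
qed (simp add: fin_run_append)

lemma run_prepend_end_state:
  "run A (initial A) (xs \<odot> \<pi>) \<longleftrightarrow> fin_run A (initial A) xs \<and> run A (end_state A xs) \<pi>"
  by (simp add: run_prepend end_state_def)

lemma run_transition:
  assumes "run A q \<pi>" "t \<in> set_fseq \<pi>"
  shows "is_transition A t"
proof (cases \<pi>)
  case (Inf p)
  then show ?thesis
    using assms by (auto simp: inf_run_def sset_range)
qed (use assms in \<open>auto intro: fin_run_transition\<close>)

lemma run_letters: "run A q \<pi> \<Longrightarrow> set_fseq (map_fseq letter \<pi>) \<subseteq> alphabet A"
  by (auto simp: fseq.set_map is_transition_def dest!: run_transition)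

lemma transition_tgt: "automaton A \<Longrightarrow> is_transition A t \<Longrightarrow> tgt t \<in> states A"
  unfolding automaton_def is_transition_def by fastforce

lemma end_state_in_states:
  "automaton A \<Longrightarrow> fin_run A (initial A) \<rho> \<Longrightarrow> end_state A \<rho> \<in> states A"
  using fin_run_transition[of A "initial A" \<rho> "last \<rho>"] transition_tgt[of A "last \<rho>"]
  by (auto simp: end_state_def automaton_def)

lemma ex_transition:
  assumes "automaton A" "q \<in> states A" "a \<in> alphabet A"
  shows "\<exists>t. is_transition A t \<and> src t = q \<and> letter t = a"
proof -
  obtain x q' where "(x, q') \<in> delta A q a"
    using assms unfolding automaton_def by (metis equals0I surj_pair)
  then show ?thesis
    using assms by (intro exI[of _ "Transition q a x q'"]) (simp add: is_transition_def)
qed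

lemma run_value_le_aut_value:
  "run A (initial A) \<pi> \<Longrightarrow> ereal (run_value V \<pi>) \<le> aut_value V A (map_fseq letter \<pi>)"
  unfolding aut_value_def by (rule SUP_upper) (simp add: runs_on_def)

lemma aut_value_le_ereal_iff:
  "aut_value V A w \<le> c \<longleftrightarrow> (\<forall>\<pi>. run A (initial A) \<pi> \<longrightarrow> map_fseq letter \<pi> = w \<longrightarrow>
     ereal (run_value V \<pi>) \<le> c)"
  unfolding aut_value_def SUP_le_iff runs_on_def by auto

section \<open>Histories and plays\<close>

lemma history_Nil [simp]: "history A s []"
  by (simp add: history_def)

lemma history_snoc:
  "history A s (\<rho> @ [t]) \<longleftrightarrow>
     history A s \<rho> \<and> is_transition A t \<and> src t = end_state A \<rho> \<and> t = s \<rho> (letter t)"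
  unfolding history_def
  by (auto simp: fin_run_append end_state_def nth_append less_Suc_eq)

lemma history_append: "history A s (\<rho> @ \<rho>') \<Longrightarrow> history A s \<rho>"
  by (induction \<rho>' rule: rev_induct) (auto simp: history_snoc simp flip: append_assoc)

lemma play_iff_history: "play A s \<pi> \<longleftrightarrow> (\<forall>n. history A s (stake n \<pi>))"
proof
  show "\<forall>n. history A s (stake n \<pi>)" if "play A s \<pi>"
    using that unfolding play_def history_def inf_run_iff_stake
    by (auto simp: stake_nth take_stake min_def)
next
  assume hist: "\<forall>n. history A s (stake n \<pi>)"
  have "\<pi> !! n = s (stake n \<pi>) (letter (\<pi> !! n))" for n
    using hist[rule_format, of "Suc n"] unfolding stake_Suc history_snoc by blast
  moreover have "inf_run A (initial A) \<pi>"
    using hist by (simp add: inf_run_iff_stake history_def)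
  ultimately show "play A s \<pi>"
    unfolding play_def by blast
qed

lemma history_extend:
  assumes "is_strategy A s" "history A s \<rho>" "\<sigma> \<in> alphabet A"
  shows "history A s (\<rho> @ [s \<rho> \<sigma>])" "letter (s \<rho> \<sigma>) = \<sigma>"
proof -
  have "fin_run A (initial A) \<rho>"
    using assms(2) by (simp add: history_def)
  then have "is_transition A (s \<rho> \<sigma>) \<and> src (s \<rho> \<sigma>) = end_state A \<rho> \<and> letter (s \<rho> \<sigma>) = \<sigma>"
    using assms(1,3) by (simp add: is_strategy_def)
  then show "history A s (\<rho> @ [s \<rho> \<sigma>])" "letter (s \<rho> \<sigma>) = \<sigma>"
    using assms(2) by (simp_all add: history_snoc)
qed

section \<open>Playing a strategy against a given word\<close>

primcorec continue :: "('a, 'q) strategy \<Rightarrow> ('a, 'q) transition list \<Rightarrow> 'a stream \<Rightarrow>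
    ('a, 'q) transition stream" where
  "shd (continue s \<rho> w) = s \<rho> (shd w)"
| "stl (continue s \<rho> w) = continue s (\<rho> @ [s \<rho> (shd w)]) (stl w)"

text \<open>Each round moves one transition from the continuation into the history, on which the
  strategy's next answer depends. The induction therefore varies both \<rho> and
  \<open>w\<close>.\<close>

lemma history_continue:
  assumes "is_strategy A s" "history A s \<rho>" "w \<in> streams (alphabet A)"
  shows "history A s (\<rho> @ stake n (continue s \<rho> w)) \<and> letter (continue s \<rho> w !! n) = w !! n"
  using assms(2,3)
proof (induction n arbitrary: \<rho> w)
  case 0
  then have "shd w \<in> alphabet A"
    by (simp add: streams_shd)
  then show ?case
    using history_extend(2)[OF assms(1) 0(1)] 0(1) by simp
next
  case (Suc n)
  then have "shd w \<in> alphabet A" "stl w \<in> streams (alphabet A)"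
    by (simp_all add: streams_shd streams_stl)
  then show ?case
    using Suc.IH[OF history_extend(1)[OF assms(1) Suc.prems(1)]] by simp
qed

lemma play_continue:
  assumes "is_strategy A s" "history A s \<rho>" "w \<in> streams (alphabet A)"
  shows "play A s (\<rho> @- continue s \<rho> w)" "smap letter (continue s \<rho> w) = w"
proof -
  have "history A s (stake n (\<rho> @- continue s \<rho> w))" for n
  proof (rule history_append)
    \<comment> \<open>The prefix of length \<open>n\<close> may end inside \<rho>. Lengthened by
      \<open>length \<rho>\<close> it consists of \<rho> and \<open>n\<close> transitions of the
      continuation, which is a history, and histories are closed under prefixes.\<close>
    have "stake n (\<rho> @- continue s \<rho> w) @
        stake (length \<rho>) (sdrop n (\<rho> @- continue s \<rho> w)) =
        stake (length \<rho> + n) (\<rho> @- continue s \<rho> w)"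
      by (simp add: stake_add add.commute)
    also have "\<dots> = \<rho> @ stake n (continue s \<rho> w)"
      by (simp add: stake_shift)
    finally show "history A s (stake n (\<rho> @- continue s \<rho> w) @
        stake (length \<rho>) (sdrop n (\<rho> @- continue s \<rho> w)))"
      using history_continue[OF assms] by metis
  qed
  then show "play A s (\<rho> @- continue s \<rho> w)"
    by (simp add: play_iff_history)
  show "smap letter (continue s \<rho> w) = w"
    unfolding smap_alt using history_continue[OF assms] by blast
qed

text \<open>One notion for both kinds of sequences, so that the main arguments need no case
  distinction on the value function.\<close>

primrec follows :: "('a, 'q) qaut \<Rightarrow> ('a, 'q) strategy \<Rightarrow> ('a, 'q) transition fseq \<Rightarrow> bool" where
  "follows A s (Fin \<rho>) \<longleftrightarrow> history A s \<rho>"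
| "follows A s (Inf \<pi>) \<longleftrightarrow> play A s \<pi>"

text \<open>A play is reduced to its prefixes. The automaton \<open>B\<close> and the state
  \<open>q\<close> are left free so that this covers \<open>A\<close> itself as well as a pruned
  automaton that confines the strategy.\<close>

lemma follows_run:
  assumes "follows A s \<pi>" "\<And>\<rho>. history A s \<rho> \<Longrightarrow> fin_run B q \<rho>"
  shows "run B q \<pi>"
  using assms by (cases \<pi>) (auto simp: play_iff_history inf_run_iff_stake)

lemma follows_run_self: "follows A s \<pi> \<Longrightarrow> run A (initial A) \<pi>"
  by (rule follows_run) (auto simp: history_def)

lemma ex_follows:
  assumes "automaton A" "is_strategy A s" "history A s \<rho>" "w \<in> seqs V (alphabet A)"
  shows "\<exists>\<pi>. map_fseq letter \<pi> = w \<and> follows A s (\<rho> \<odot> \<pi>)"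
proof (cases w)
  case (Inf u)
  then have "u \<in> streams (alphabet A)"
    using assms(4) by (cases V) auto
  then show ?thesis
    using play_continue[OF assms(2,3)] Inf
    by (intro exI[of _ "Inf (continue s \<rho> u)"]) auto
next
  case (Fin u)
  \<comment> \<open>A finite word is padded with a fixed letter to an infinite one, played out, and
    the result truncated to the original length.\<close>
  obtain a where "a \<in> alphabet A"
    using assms(1) by (auto simp: automaton_def)
  moreover have "u \<in> lists (alphabet A)"
    using assms(4) Fin by (cases V) auto
  ultimately have w: "u @- sconst a \<in> streams (alphabet A)"
    by (simp add: shift_streams sconst_streams)
  let ?p = "stake (length u) (continue s \<rho> (u @- sconst a))"
  have "map letter ?p = stake (length u) (smap letter (continue s \<rho> (u @- sconst a)))"
    by simp
  also have "\<dots> = u"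
    unfolding play_continue(2)[OF assms(2,3) w] by (simp add: stake_shift)
  finally have "map letter ?p = u" .
  then show ?thesis
    using history_continue[OF assms(2,3) w] Fin by (intro exI[of _ "Fin ?p"]) auto
qed

text \<open>The game is infinite even for finite words, so \<open>winning\<close> speaks of a finite
  history only through a play that extends it.\<close>

lemma winning_follows_dominates:
  assumes "automaton A" "is_strategy A s" "winning V A s" "follows A s \<pi>" "\<pi> \<in> seqs V UNIV"
  shows "dominates V A \<pi>"
proof (cases V)
  case (InfVal f)
  then show ?thesis
    using assms(3,4,5) by (auto simp: winning_def)
next
  case (FinVal f)
  then obtain \<rho> where \<rho>: "\<pi> = Fin \<rho>" "history A s \<rho>"
    using assms(4,5) by auto
  show ?thesis
  proof (cases "\<rho> = []")
    case True
    \<comment> \<open>\<open>eve_wins\<close> inspects only prefixes of positive length. On the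
      empty word the empty run is the only one, so it attains the supremum.\<close>
    have "p = Fin []" if "map_fseq letter p = Fin []" for p :: "('a, 'b) transition fseq"
      using that by (cases p) auto
    then show ?thesis
      using \<rho> True by (auto simp: dominates_def aut_value_le_ereal_iff)
  next
    case False
    obtain a where "a \<in> alphabet A"
      using assms(1) by (auto simp: automaton_def)
    then have "sconst a \<in> streams (alphabet A)"
      by (simp add: sconst_streams)
    from play_continue(1)[OF assms(2) \<rho>(2) this] obtain p where "play A s (\<rho> @- p)"
      by blast
    \<comment> \<open>The index is \<open>length \<rho> - 1\<close> because \<open>eve_wins\<close>
      numbers the prefixes by \<open>Suc i\<close>.\<close>
    then have "dominates V A (Fin (stake (Suc (length \<rho> - 1)) (\<rho> @- p)))"
      using assms(3) unfolding winning_def FinVal eve_wins.simps by blast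
    moreover have "Suc (length \<rho> - 1) = length \<rho>"
      using False by simp
    ultimately show ?thesis
      unfolding \<rho>(1) by (simp add: stake_shift)
  qed
qed

section \<open>Cautious moves\<close>

text \<open>If a move \<open>t\<close> after \<rho> were non-cautious, Adam could play the
  witnessing word. Eve's run then starts with \<rho> and \<open>t\<close> and is strictly worse than
  \<rho> followed by the witnessing run, which is a run on the same word, so she fails to reach its
  value.\<close>

lemma winning_imp_cautious:
  assumes "automaton A" "is_strategy A s" "winning V A s"
  shows "cautious V A s"
  unfolding cautious_def
proof (intro allI impI notI)
  fix \<rho> \<sigma>
  assume \<rho>: "history A s \<rho>" and \<sigma>: "\<sigma> \<in> alphabet A"
    and bad: "non_cautious_move V A \<rho> (s \<rho> \<sigma>)"
  let ?t = "s \<rho> \<sigma>"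
  have t: "history A s (\<rho> @ [?t])" "letter ?t = \<sigma>"
    using history_extend[OF assms(2) \<rho> \<sigma>] by auto
  then have src: "src ?t = end_state A \<rho>"
    by (simp add: history_snoc)
  from bad obtain w \<pi>' where w: "w \<in> seqs V (alphabet A)"
    and \<pi>': "\<pi>' \<in> runs_on A (src ?t) ([\<sigma>] \<odot> w)"
    and better: "\<And>p. [?t] \<odot> p \<in> runs_on A (src ?t) ([\<sigma>] \<odot> w) \<Longrightarrow>
      run_value V (\<rho> \<odot> \<pi>') > run_value V (\<rho> \<odot> [?t] \<odot> p)"
    unfolding non_cautious_move_def t(2) by blast
  obtain p where p: "map_fseq letter p = w" "follows A s (\<rho> \<odot> [?t] \<odot> p)"
    using ex_follows[OF assms(1,2) t(1) w] by (auto simp: prepend_append)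
  have run: "fin_run A (initial A) \<rho>" "run A (src ?t) ([?t] \<odot> p)"
    using follows_run_self[OF p(2)] by (auto simp: run_prepend_end_state src)
  have "\<rho> \<odot> [?t] \<odot> p \<in> seqs V UNIV"
    using w p(1) by (cases V; cases p) auto
  then have "aut_value V A (map letter \<rho> \<odot> [\<sigma>] \<odot> w) \<le> run_value V (\<rho> \<odot> [?t] \<odot> p)"
    using winning_follows_dominates[OF assms p(2)]
    by (simp add: dominates_def map_fseq_prepend p(1) t(2))
  moreover have "ereal (run_value V (\<rho> \<odot> \<pi>')) \<le> aut_value V A (map letter \<rho> \<odot> [\<sigma>] \<odot> w)"
    using run_value_le_aut_value[of A "\<rho> \<odot> \<pi>'" V] \<pi>' run(1)
    by (auto simp: run_prepend_end_state src runs_on_def map_fseq_prepend)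
  moreover have "run_value V (\<rho> \<odot> \<pi>') > run_value V (\<rho> \<odot> [?t] \<odot> p)"
    using better[of p] run(2) p(1) t(2) by (auto simp: runs_on_def map_fseq_prepend)
  ultimately have "ereal (run_value V (\<rho> \<odot> \<pi>')) < ereal (run_value V (\<rho> \<odot> \<pi>'))"
    by (meson ereal_less_eq(3) leD order_trans)
  then show False by simp
qed

section \<open>Independence of caution from the past run\<close>

definition weights :: "('a, 'q) qaut \<Rightarrow> rat set" where
  "weights A = (\<Union>q\<in>states A. \<Union>a\<in>alphabet A. fst ` delta A q a)"

lemma finite_weights: "automaton A \<Longrightarrow> finite (weights A)"
  unfolding automaton_def weights_def by blast

lemma transition_weight: "is_transition A t \<Longrightarrow> weight t \<in> weights A"
  unfolding is_transition_def weights_def by force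

text \<open>Negating suffix monotonicity, with the finite set \<open>weights A\<close> as its
  \<open>S\<close>, gives the strict form. Only weight sequences are compared, so \<open>q1\<close>
  and \<open>q2\<close> need not be the state where \<rho> ends.\<close>

lemma suffix_monotonic_less_iff:
  assumes "suffix_monotonic V" "automaton A" "fin_run A q \<rho>"
    and "\<pi> \<in> runs_on A q1 w" "\<pi>' \<in> runs_on A q2 w" "w \<in> seqs V UNIV"
  shows "run_value V (\<rho> \<odot> \<pi>) < run_value V (\<rho> \<odot> \<pi>') \<longleftrightarrow> run_value V \<pi> < run_value V \<pi>'"
proof -
  have seq: "map_fseq weight p \<in> seqs V (weights A)" if p: "p \<in> runs_on A q' w" for p q'
  proof -
    have "p \<in> seqs V UNIV"
      using p assms(6) by (auto simp: runs_on_def seqs_UNIV_map)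
    moreover have "set_fseq (map_fseq weight p) \<subseteq> weights A"
      using p by (auto simp: runs_on_def fseq.set_map dest: run_transition intro: transition_weight)
    ultimately show ?thesis
      by (subst seqs_iff) (simp add: seqs_UNIV_map)
  qed
  have "map weight \<rho> \<in> lists (weights A)"
    using fin_run_transition[OF assms(3)] transition_weight[of A] by auto
  then show ?thesis
    using assms(1)[unfolded suffix_monotonic_def, rule_format, OF finite_weights[OF assms(2)] _
        seq[OF assms(4)] seq[OF assms(5)], of "map weight \<rho>"]
    by (simp add: run_value_def map_fseq_prepend not_le[symmetric])
qed

text \<open>The definition compares only values of runs prolonging the same \<rho>, and suffix
  monotonicity cancels this common prefix. Caution thus becomes a property of the transition
  alone.\<close>

lemma non_cautious_move_iff:
  assumes "suffix_monotonic V" "automaton A" "fin_run A (initial A) \<rho>"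
  shows "non_cautious_move V A \<rho> t \<longleftrightarrow> non_cautious_move V A [] t"
proof -
  have *: "[letter t] \<odot> w \<in> seqs V UNIV" if "w \<in> seqs V (alphabet A)" for w
    using that by (cases V; cases w) auto
  show ?thesis
    unfolding non_cautious_move_def prepend_Nil
    by (intro bex_cong ball_cong refl)
      (simp add: suffix_monotonic_less_iff[OF assms _ _ *])
qed

section \<open>Renaming letters and states\<close>

text \<open>A renaming that respects transitions lifts to runs. It is used in both directions
  between an automaton and its numbered copy and, with identities, for pruned automata.\<close>

lemma fin_run_map:
  assumes "\<And>t. is_transition A t \<Longrightarrow> is_transition B (map_transition f g t)" "fin_run A q \<rho>"
  shows "fin_run B (g q) (map (map_transition f g) \<rho>)"
  using assms(2) by (induction \<rho> arbitrary: q) (auto simp: assms(1) transition.map_sel)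

lemma run_map:
  assumes "\<And>t. is_transition A t \<Longrightarrow> is_transition B (map_transition f g t)" "run A q \<pi>"
  shows "run B (g q) (map_fseq (map_transition f g) \<pi>)"
proof (cases \<pi>)
  case (Inf p)
  then show ?thesis
    using assms(2) fin_run_map[where A = A and B = B, OF assms(1)]
    by (simp add: inf_run_iff_stake)
qed (use assms fin_run_map[where A = A and B = B, OF assms(1)] in auto)

lemma letter_map_fseq:
  "map_fseq letter (map_fseq (map_transition f g) \<pi>) = map_fseq f (map_fseq letter \<pi>)"
  by (simp add: fseq.map_comp o_def transition.map_sel)

lemma runs_on_map:
  assumes "\<And>t. is_transition A t \<Longrightarrow> is_transition B (map_transition f g t)" "\<pi> \<in> runs_on A q w"
  shows "map_fseq (map_transition f g) \<pi> \<in> runs_on B (g q) (map_fseq f w)"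
  using assms(2) run_map[where A = A and B = B, OF assms(1)]
  by (auto simp: runs_on_def letter_map_fseq)

lemma run_value_map [simp]:
  "run_value V (map_fseq (map_transition f g) \<pi>) = run_value V \<pi>"
  by (simp add: run_value_def fseq.map_comp o_def transition.map_sel)

text \<open>Each run of \<open>A\<close> is mapped to a run of \<open>B\<close> with the same
  weights, so the supremum can only grow.\<close>

lemma aut_value_map_le:
  assumes "\<And>t. is_transition A t \<Longrightarrow> is_transition B (map_transition f g t)"
    and "initial B = g (initial A)"
  shows "aut_value V A w \<le> aut_value V B (map_fseq f w)"
  unfolding aut_value_le_ereal_iff
  using run_value_le_aut_value[of B _ V] run_map[where A = A and B = B, OF assms(1)]
  by (metis assms(2) letter_map_fseq run_value_map)

lemma end_state_map:
  "initial B = g (initial A) \<Longrightarrow> end_state B (map (map_transition f g) \<rho>) = g (end_state A \<rho>)"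
  by (simp add: end_state_def last_map transition.map_sel)

text \<open>\<open>present_focused\<close> quantifies over automata on natural numbers. The strategy
  is moved to an isomorphic copy of that type, shown cautious there, and the resulting win is moved
  back.\<close>

lemma present_focused_winning:
  fixes A :: "('a, 'q) qaut"
  assumes "present_focused V" "automaton A" "is_strategy A s" "cautious V A s"
  shows "winning V A s"
proof -
  \<comment> \<open>\<open>f\<close> and \<open>g\<close> number the finite sets of letters and
    states; \<open>f'\<close> and \<open>g'\<close> invert them on these sets only. Hence
    \<open>h\<close> and \<open>h'\<close> below are inverse to each other on transitions of the two
    automata, not on arbitrary ones.\<close>
  define f where "f = to_nat_on (alphabet A)"
  define g where "g = to_nat_on (states A)"
  define f' where "f' = from_nat_into (alphabet A)"
  define g' where "g' = from_nat_into (states A)"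
  have f: "f' (f a) = a" if "a \<in> alphabet A" for a
    using that assms(2) by (simp add: f_def f'_def automaton_def countable_finite)
  have g: "g' (g q) = q" if "q \<in> states A" for q
    using that assms(2) by (simp add: g_def g'_def automaton_def countable_finite)
  define B :: "(nat, nat) qaut" where
    "B = \<lparr>alphabet = f ` alphabet A, states = g ` states A, initial = g (initial A),
      delta = \<lambda>q a. map_prod id g ` delta A (g' q) (f' a)\<rparr>"
  define h where "h = map_transition f g"
  define h' where "h' = map_transition f' g'"
  have B_sel: "alphabet B = f ` alphabet A" "states B = g ` states A" "initial B = g (initial A)"
    "delta B = (\<lambda>q a. map_prod id g ` delta A (g' q) (f' a))"
    by (simp_all add: B_def)
  have initA: "initial A \<in> states A"
    using assms(2) by (simp add: automaton_def)
  have init': "initial A = g' (initial B)"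
    using initA by (simp add: B_sel g)
  have AB: "is_transition B (h t)" and h'h: "h' (h t) = t" if "is_transition A t" for t
    using that transition_tgt[OF assms(2) that]
    by (cases t; force simp: is_transition_def h_def h'_def B_sel f g)+
  have BA: "is_transition A (h' t)" and hh': "h (h' t) = t" if t': "is_transition B t" for t
  proof -
    obtain q a x q' where t: "t = Transition q a x q'"
      by (cases t)
    obtain p b where pb: "q = g p" "p \<in> states A" "a = f b" "b \<in> alphabet A"
      using t' by (auto simp: t is_transition_def B_sel)
    then obtain p' where p': "q' = g p'" "(x, p') \<in> delta A p b"
      using t' by (auto simp: t is_transition_def B_sel f g)
    then have "p' \<in> states A"
      using assms(2) pb unfolding automaton_def by blast
    then show "is_transition A (h' t)" "h (h' t) = t"
      using pb p' by (auto simp: t is_transition_def h_def h'_def f g)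
  qed
  note AB' = AB[unfolded h_def] and BA' = BA[unfolded h'_def]
  have autB: "automaton B"
    using assms(2) unfolding automaton_def B_sel by (auto simp: f g image_subset_iff) blast
  \<comment> \<open>The strategy of the copy decodes history and letter, consults \<open>s\<close>,
    and encodes the answer.\<close>
  define s' where "s' = (\<lambda>\<rho> \<sigma>. h (s (map h' \<rho>) (f' \<sigma>)))"
  have strat: "is_strategy B s'"
    unfolding is_strategy_def
  proof (intro allI impI)
    fix \<rho> \<sigma>
    assume \<rho>: "fin_run B (initial B) \<rho>" and \<sigma>: "\<sigma> \<in> alphabet B"
    have run: "fin_run A (initial A) (map h' \<rho>)"
      using fin_run_map[where A = B and B = A, OF BA' \<rho>] by (simp add: init' h'_def)
    have end_eq: "end_state A (map h' \<rho>) = g' (end_state B \<rho>)"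
      unfolding h'_def by (rule end_state_map[where A = B and B = A and g = g', OF init'])
    have "f' \<sigma> \<in> alphabet A" "f (f' \<sigma>) = \<sigma>"
      using \<sigma> by (auto simp: B_sel f)
    moreover from this have "is_transition A (s (map h' \<rho>) (f' \<sigma>))"
      "src (s (map h' \<rho>) (f' \<sigma>)) = g' (end_state B \<rho>)" "letter (s (map h' \<rho>) (f' \<sigma>)) = f' \<sigma>"
      using assms(3) run end_eq by (auto simp: is_strategy_def)
    moreover have "g (g' (end_state B \<rho>)) = end_state B \<rho>"
      using end_state_in_states[OF autB \<rho>] by (auto simp: B_sel g)
    ultimately show "is_transition B (s' \<rho> \<sigma>) \<and> src (s' \<rho> \<sigma>) = end_state B \<rho> \<and> letter (s' \<rho> \<sigma>) = \<sigma>"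
      using AB by (simp add: s'_def) (simp add: h_def transition.map_sel)
  qed
  \<comment> \<open>Caution of \<open>s\<close> is assumed only along its own histories, so decoded
    histories of \<open>s'\<close> have to be among these.\<close>
  have hist: "history A s (map h' \<rho>)" if "history B s' \<rho>" for \<rho>
    using that
  proof (induction \<rho> rule: rev_induct)
    case (snoc t \<rho>)
    then have t: "history B s' \<rho>" "is_transition B t" "t = s' \<rho> (letter t)"
      by (auto simp: history_snoc)
    have IH: "history A s (map h' \<rho>)"
      using snoc t by simp
    have l: "f' (letter t) \<in> alphabet A"
      using t(2) by (auto simp: is_transition_def B_sel f)
    have "is_transition A (s (map h' \<rho>) (f' (letter t)))"
      using assms(3) IH l by (auto simp: is_strategy_def history_def)
    then have "h' t = s (map h' \<rho>) (f' (letter t))"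
      using h'h by (subst t(3)) (simp add: s'_def)
    then show ?case
      using history_extend(1)[OF assms(3) IH l] by simp
  qed simp
  have "cautious V B s'"
    unfolding cautious_def
  proof (intro allI impI notI)
    fix \<rho> \<sigma>
    assume \<rho>: "history B s' \<rho>" and \<sigma>: "\<sigma> \<in> alphabet B"
      and bad: "non_cautious_move V B \<rho> (s' \<rho> \<sigma>)"
    define t where "t = s' \<rho> \<sigma>"
    have t: "is_transition B t"
      using strat \<rho> \<sigma> by (auto simp: is_strategy_def history_def t_def)
    have f'\<sigma>: "f' \<sigma> \<in> alphabet A"
      using \<sigma> by (auto simp: B_sel f)
    have h't: "h' t = s (map h' \<rho>) (f' \<sigma>)"
      using assms(3) hist[OF \<rho>] f'\<sigma> h'h
      by (auto simp: is_strategy_def history_def t_def s'_def)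
    from bad obtain w \<pi>' where w: "w \<in> seqs V (alphabet B)"
      and \<pi>': "\<pi>' \<in> runs_on B (src t) ([letter t] \<odot> w)"
      and better: "\<And>p. [t] \<odot> p \<in> runs_on B (src t) ([letter t] \<odot> w) \<Longrightarrow>
        run_value V (\<rho> \<odot> \<pi>') > run_value V (\<rho> \<odot> [t] \<odot> p)"
      unfolding non_cautious_move_def t_def by blast
    \<comment> \<open>The decoded word and run witness that the decoded move is non-cautious. A
      competing run of \<open>A\<close> is beaten because its encoding competes in \<open>B\<close>,
      and renaming preserves values.\<close>
    have "non_cautious_move V A (map h' \<rho>) (h' t)"
      unfolding non_cautious_move_def
    proof (intro bexI ballI impI)
      show "map_fseq f' w \<in> seqs V (alphabet A)"
        using w by (rule map_fseq_in_seqs) (auto simp: B_sel f)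
      show \<pi>'A: "map_fseq h' \<pi>' \<in> runs_on A (src (h' t)) ([letter (h' t)] \<odot> map_fseq f' w)"
        using runs_on_map[where A = B and B = A, OF BA' \<pi>']
        by (simp add: h'_def map_fseq_prepend transition.map_sel)
      fix \<pi>
      assume \<pi>: "\<pi> \<in> runs_on A (src (h' t)) ([letter (h' t)] \<odot> map_fseq f' w)"
        and "\<exists>p. \<pi> = [h' t] \<odot> p"
      then obtain p where p: "\<pi> = [h' t] \<odot> p"
        by blast
      have ff': "map_fseq f (map_fseq f' w) = w"
        unfolding fseq.map_comp o_def
        using iffD1[OF seqs_iff w] by (intro map_fseq_ident) (auto simp: B_sel f)
      have "g (src (h' t)) = src t" "f (letter (h' t)) = letter t"
        using hh'[OF t] by (metis h_def transition.map_sel(1), metis h_def transition.map_sel(2))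
      then have "[t] \<odot> map_fseq h p \<in> runs_on B (src t) ([letter t] \<odot> w)"
        using runs_on_map[where A = A and B = B, OF AB' \<pi>] hh'[OF t]
        by (simp add: p map_fseq_prepend ff' flip: h_def)
      note better[OF this]
      moreover have "\<rho> \<odot> [t] \<odot> map_fseq h p = map_fseq h (map h' \<rho> \<odot> \<pi>)"
      proof -
        have "map (h \<circ> h') \<rho> = \<rho>"
          using \<rho> hh' by (intro map_idI) (auto simp: history_def dest: fin_run_transition)
        then show ?thesis
          by (simp add: p map_fseq_prepend hh'[OF t])
      qed
      moreover have "map h' \<rho> \<odot> map_fseq h' \<pi>' = map_fseq h' (\<rho> \<odot> \<pi>')"
        by (simp add: map_fseq_prepend)
      ultimately show "run_value V (map h' \<rho> \<odot> \<pi>) < run_value V (map h' \<rho> \<odot> map_fseq h' \<pi>')"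
        by (simp add: h_def h'_def)
    qed
    then show False
      using assms(4) hist[OF \<rho>] f'\<sigma> unfolding cautious_def h't by blast
  qed
  then have win: "winning V B s'"
    using assms(1) autB strat by (simp add: present_focused_def)
  \<comment> \<open>One inequality between the automaton values suffices: the run keeps its value,
    and the bound it meets in \<open>B\<close> is at least the one in \<open>A\<close>.\<close>
  have dom: "dominates V A \<pi>" if "dominates V B (map_fseq h \<pi>)" for \<pi>
    using that aut_value_map_le[where A = A and B = B, OF AB' B_sel(3), of V "map_fseq letter \<pi>"]
    by (simp add: dominates_def letter_map_fseq h_def)
  show ?thesis
    unfolding winning_def
  proof (intro allI impI)
    fix \<pi>
    assume \<pi>: "play A s \<pi>"
    have trans: "is_transition A (\<pi> !! i)" for i
      using \<pi> by (simp add: play_def inf_run_def)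
    \<comment> \<open>The encoding of a play of \<open>s\<close> is shown to be a play of
      \<open>s'\<close>, which Eve wins.\<close>
    have "run B (initial B) (map_fseq h (Inf \<pi>))"
      using run_map[where A = A and B = B, OF AB', of "initial A" "Inf \<pi>"] \<pi>
      by (simp add: play_def h_def B_sel)
    moreover have "smap h \<pi> !! i = s' (stake i (smap h \<pi>)) (letter (smap h \<pi> !! i))" for i
    proof -
      have "map h' (map h (stake i \<pi>)) = stake i \<pi>"
        using trans h'h by (auto simp: list_eq_iff_nth_eq stake_nth)
      moreover have "f' (letter (h (\<pi> !! i))) = letter (\<pi> !! i)"
        using trans[of i] by (simp add: h_def transition.map_sel f is_transition_def)
      moreover have "\<pi> !! i = s (stake i \<pi>) (letter (\<pi> !! i))"
        using \<pi> by (simp add: play_def)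
      ultimately show ?thesis
        by (simp add: s'_def)
    qed
    ultimately have "play B s' (smap h \<pi>)"
      unfolding play_def by simp
    then have "eve_wins V B (smap h \<pi>)"
      using win by (simp add: winning_def)
    then show "eve_wins V A \<pi>"
    proof (cases V)
      case (FinVal F)
      then have "dominates V B (map_fseq h (Fin (stake (Suc i) \<pi>)))" for i
        using \<open>eve_wins V B (smap h \<pi>)\<close>
        by (simp del: stake.simps)
      then show ?thesis
        using dom FinVal by (simp del: stake.simps)
    next
      case (InfVal F)
      then show ?thesis
        using dom[of "Inf \<pi>"] \<open>eve_wins V B (smap h \<pi>)\<close> by simp
    qed
  qed
qed

section \<open>Pruning\<close>

text \<open>Isolates the clauses of \<open>determinizable_by_pruning\<close> on removing states and
  transitions, apart from determinism and equivalence.\<close>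

definition prunes :: "('a, 'q) qaut \<Rightarrow> ('a, 'q) qaut \<Rightarrow> bool" where
  "prunes B A \<longleftrightarrow>
     alphabet B = alphabet A \<and> states B \<subseteq> states A \<and> initial B = initial A \<and>
     (\<forall>q\<in>states B. \<forall>a\<in>alphabet B. delta B q a \<subseteq> delta A q a)"

lemma prunes_transition: "prunes B A \<Longrightarrow> is_transition B t \<Longrightarrow> is_transition A t"
  unfolding prunes_def is_transition_def by blast

lemma prunes_run:
  assumes "prunes B A" "run B q \<pi>"
  shows "run A q \<pi>"
proof -
  have "map_transition id id t = t" for t :: "('a, 'b) transition"
    by (simp add: transition.map_id)
  then show ?thesis
    using run_map[where A = B and B = A and f = id and g = id, OF _ assms(2)]
      prunes_transition[OF assms(1)]
    by (simp add: map_fseq_ident)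
qed

text \<open>Choosing a transition of \<open>B\<close> at every state of \<open>B\<close> keeps the
  run inside \<open>B\<close>, since it starts there. Elsewhere any transition of \<open>A\<close>
  is chosen, as \<open>is_strategy\<close> requires a legal answer after every run of
  \<open>A\<close> from the initial state.\<close>

lemma ex_strategy_inside:
  assumes "automaton A" "automaton B" "prunes B A"
  shows "\<exists>s. is_strategy A s \<and> (\<forall>\<rho>. history A s \<rho> \<longrightarrow> fin_run B (initial B) \<rho>)"
proof -
  have "\<exists>t. q \<in> states A \<longrightarrow> a \<in> alphabet A \<longrightarrow> is_transition A t \<and> src t = q \<and> letter t = a \<and>
      (q \<in> states B \<longrightarrow> is_transition B t)" for q a
    using ex_transition[OF assms(1)] ex_transition[OF assms(2)] prunes_transition[OF assms(3)]
      assms(3)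
    by (metis prunes_def)
  then obtain c where c: "\<And>q a. q \<in> states A \<Longrightarrow> a \<in> alphabet A \<Longrightarrow>
      is_transition A (c q a) \<and> src (c q a) = q \<and> letter (c q a) = a \<and>
      (q \<in> states B \<longrightarrow> is_transition B (c q a))"
    by metis
  define s where "s = (\<lambda>\<rho>. c (end_state A \<rho>))"
  have "is_strategy A s"
    unfolding is_strategy_def s_def using c end_state_in_states[OF assms(1)] by blast
  moreover have "fin_run B (initial B) \<rho>" if "history A s \<rho>" for \<rho>
    using that
  proof (induction \<rho> rule: rev_induct)
    case (snoc t \<rho>)
    then have run: "fin_run B (initial B) \<rho>" and t: "is_transition A t" "src t = end_state A \<rho>"
      "t = c (end_state A \<rho>) (letter t)"
      by (auto simp: history_snoc s_def)
    have "end_state A \<rho> = end_state B \<rho>"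
      using assms(3) by (simp add: prunes_def end_state_def)
    then have "end_state A \<rho> \<in> states B"
      using end_state_in_states[OF assms(2) run] by simp
    then have "is_transition B t"
      using c[of "end_state A \<rho>" "letter t"] t by (auto simp: is_transition_def)
    then show ?case
      using run t(2) assms(3) by (simp add: fin_run_append end_state_def prunes_def)
  qed simp
  ultimately show ?thesis by blast
qed

section \<open>Uniqueness of runs in deterministic automata\<close>

lemma deterministic_fin_run_unique:
  assumes "deterministic B"
  shows "fin_run B q xs \<Longrightarrow> fin_run B q ys \<Longrightarrow> map letter xs = map letter ys \<Longrightarrow> xs = ys"
proof (induction xs arbitrary: q ys)
  case (Cons t xs)
  then obtain u ys' where ys: "ys = u # ys'"
    by auto
  have "is_transition B t" "is_transition B u" "src t = src u" "letter t = letter u"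
    using Cons.prems by (auto simp: ys)
  then have "(weight t, tgt t) = (weight u, tgt u)"
    using assms unfolding deterministic_def is_transition_def
    by (metis is_singletonE singletonD)
  then have "t = u"
    using \<open>src t = src u\<close> \<open>letter t = letter u\<close> by (auto intro: transition.expand)
  then show ?case
    using Cons by (auto simp: ys)
qed simp

lemma deterministic_run_unique:
  assumes "deterministic B" "run B q \<pi>" "run B q \<pi>'" "map_fseq letter \<pi> = map_fseq letter \<pi>'"
  shows "\<pi> = \<pi>'"
proof (cases \<pi>)
  case (Fin xs)
  then show ?thesis
    using assms deterministic_fin_run_unique[OF assms(1)] by (cases \<pi>') auto
next
  case (Inf p)
  then obtain p' where p': "\<pi>' = Inf p'" "smap letter p = smap letter p'"
    using assms(4) by (cases \<pi>') auto
  have "stake n p = stake n p'" for n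
  proof (rule deterministic_fin_run_unique[OF assms(1)])
    show "map letter (stake n p) = map letter (stake n p')"
      using p'(2) by (metis stake_smap)
  qed (use assms Inf p' in \<open>auto simp: inf_run_iff_stake\<close>)
  then have "p !! n = p' !! n" for n
    by (metis stake_nth lessI)
  then have "p = p'"
    by (metis ext stream_smap_nats)
  then show ?thesis
    using Inf p' by simp
qed

section \<open>The two directions of the equivalence\<close>

lemma prunable_imp_history_deterministic:
  assumes "automaton A" "determinizable_by_pruning V A"
  shows "history_deterministic V A"
proof -
  obtain B where B: "automaton B" "deterministic B" "equivalent V A B" "prunes B A"
    using assms(2) unfolding determinizable_by_pruning_def prunes_def by blast
  obtain s where s: "is_strategy A s" "\<And>\<rho>. history A s \<rho> \<Longrightarrow> fin_run B (initial B) \<rho>"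
    using ex_strategy_inside[OF assms(1) B(1,4)] by blast
  \<comment> \<open>Eve's run stays in the deterministic \<open>B\<close>, so it is the only run of
    \<open>B\<close> on its word. Its value is therefore the value of \<open>B\<close>, which by
    equivalence is that of \<open>A\<close>.\<close>
  have dom: "dominates V A \<pi>" if \<pi>: "follows A s \<pi>" "\<pi> \<in> seqs V UNIV" for \<pi>
  proof -
    have run: "run B (initial B) \<pi>"
      using follows_run[OF \<pi>(1) s(2)] .
    have "map_fseq letter \<pi> \<in> seqs V (alphabet A)"
      using \<pi>(2) run_letters[OF follows_run_self[OF \<pi>(1)]]
      by (subst seqs_iff) (simp add: seqs_UNIV_map)
    then have "aut_value V A (map_fseq letter \<pi>) = aut_value V B (map_fseq letter \<pi>)"
      using B(3) by (simp add: equivalent_def)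
    also have "\<dots> \<le> run_value V \<pi>"
      using deterministic_run_unique[OF B(2) _ run] by (auto simp: aut_value_le_ereal_iff)
    finally show ?thesis
      by (simp add: dominates_def)
  qed
  have "eve_wins V A \<pi>" if \<pi>: "play A s \<pi>" for \<pi>
  proof (cases V)
    case (FinVal F)
    then show ?thesis
      using dom[of "Fin (stake (Suc i) \<pi>)" for i] \<pi>
      by (simp add: play_iff_history del: stake.simps)
  next
    case (InfVal F)
    then show ?thesis
      using dom[of "Inf \<pi>"] \<pi> by simp
  qed
  then show ?thesis
    using s(1) unfolding history_deterministic_def winning_def by blast
qed

lemma history_deterministic_imp_prunable:
  assumes "present_focused V" "suffix_monotonic V" "automaton A" "history_deterministic V A"
  shows "determinizable_by_pruning V A"
proof -
  obtain s where s: "is_strategy A s" "cautious V A s"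
    using assms(3,4) winning_imp_cautious unfolding history_deterministic_def by blast
  \<comment> \<open>\<open>R\<close> fixes one representative history for each reached state; it is
    meaningful on \<open>Q\<close> only. The move \<open>s (R q) a\<close> then depends just on the
    state and the letter.\<close>
  define R where "R = (\<lambda>q. SOME \<rho>. history A s \<rho> \<and> end_state A \<rho> = q)"
  define Q where "Q = {end_state A \<rho> |\<rho>. history A s \<rho>}"
  have R: "history A s (R q)" "end_state A (R q) = q" if "q \<in> Q" for q
    using that someI_ex[of "\<lambda>\<rho>. history A s \<rho> \<and> end_state A \<rho> = q"]
    by (auto simp: R_def Q_def)
  have t: "is_transition A (s (R q) a)" "src (s (R q) a) = q" "letter (s (R q) a) = a"
    "tgt (s (R q) a) \<in> Q" if "q \<in> Q" "a \<in> alphabet A" for q a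
  proof -
    \<comment> \<open>The representative history prolonged by its move is again a history of
      \<open>s\<close>, so \<open>Q\<close> is closed under the chosen moves.\<close>
    have hist: "history A s (R q @ [s (R q) a])" "letter (s (R q) a) = a"
      using history_extend[OF s(1) R(1)[OF that(1)] that(2)] by auto
    moreover have "end_state A (R q @ [s (R q) a]) = tgt (s (R q) a)"
      by (simp add: end_state_def)
    ultimately show "tgt (s (R q) a) \<in> Q"
      unfolding Q_def by (metis (mono_tags, lifting) mem_Collect_eq)
    show "is_transition A (s (R q) a)" "src (s (R q) a) = q" "letter (s (R q) a) = a"
      using hist R(2)[OF that(1)] by (auto simp: history_snoc)
  qed
  define B :: "('a, 'b) qaut" where
    "B = \<lparr>alphabet = alphabet A, states = Q, initial = initial A,
      delta = \<lambda>q a. {(weight (s (R q) a), tgt (s (R q) a))}\<rparr>"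
  have B_sel: "alphabet B = alphabet A" "states B = Q" "initial B = initial A"
    "delta B = (\<lambda>q a. {(weight (s (R q) a), tgt (s (R q) a))})"
    by (simp_all add: B_def)
  have QA: "Q \<subseteq> states A"
    using end_state_in_states[OF assms(3)] by (auto simp: Q_def history_def)
  have "initial A \<in> Q"
    unfolding Q_def by (auto simp: end_state_def intro!: exI[of _ "[]"])
  then have autB: "automaton B"
    using assms(3) t(4) finite_subset[OF QA] unfolding automaton_def B_sel by auto
  have detB: "deterministic B"
    by (simp add: deterministic_def B_sel)
  have prunes: "prunes B A"
    unfolding prunes_def B_sel using QA t(1-3) by (auto simp: is_transition_def)
  \<comment> \<open>A run of \<open>B\<close> mixes moves made after different representatives and
    need not be a history of \<open>s\<close>. Caution is known after \<open>R (src u)\<close> and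
    is transferred to \<rho> by its independence of the past.\<close>
  have B_cautious: "\<not> non_cautious_move V A \<rho> u"
    if u: "is_transition B u" and \<rho>: "fin_run A (initial A) \<rho>" for u \<rho>
  proof -
    have q: "src u \<in> Q" "letter u \<in> alphabet A"
      using u by (auto simp: is_transition_def B_sel)
    then have "u = s (R (src u)) (letter u)"
      using u t(2,3) by (intro transition.expand) (auto simp: is_transition_def B_sel)
    moreover have "\<not> non_cautious_move V A (R (src u)) (s (R (src u)) (letter u))"
      using s(2) R(1) q unfolding cautious_def by blast
    moreover have "fin_run A (initial A) (R (src u))"
      using R(1)[OF q(1)] by (simp add: history_def)
    ultimately show ?thesis
      using non_cautious_move_iff[OF assms(2,3)] \<rho> by metis
  qed
  obtain s' where s': "is_strategy A s'" "\<And>\<rho>. history A s' \<rho> \<Longrightarrow> fin_run B (initial B) \<rho>"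
    using ex_strategy_inside[OF assms(3) autB prunes] by blast
  have "cautious V A s'"
    unfolding cautious_def
  proof (intro allI impI)
    fix \<rho> \<sigma>
    assume \<rho>: "history A s' \<rho>" and \<sigma>: "\<sigma> \<in> alphabet A"
    have "is_transition B (s' \<rho> \<sigma>)"
      using s'(2)[OF history_extend(1)[OF s'(1) \<rho> \<sigma>]] by (simp add: fin_run_append)
    then show "\<not> non_cautious_move V A \<rho> (s' \<rho> \<sigma>)"
      using B_cautious \<rho> by (simp add: history_def)
  qed
  then have win: "winning V A s'"
    by (rule present_focused_winning[OF assms(1,3) s'(1)])
  have "aut_value V A w = aut_value V B w" if w: "w \<in> seqs V (alphabet A)" for w
  proof (rule antisym)
    show "aut_value V B w \<le> aut_value V A w"
      using prunes_run[OF prunes] run_value_le_aut_value[of A _ V]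
      by (auto simp: aut_value_le_ereal_iff B_sel)
    \<comment> \<open>Following \<open>s'\<close> on \<open>w\<close> gives a run that lies in
      \<open>B\<close> and, since \<open>s'\<close> wins, reaches the value of
      \<open>A\<close>.\<close>
    obtain \<pi> where \<pi>: "map_fseq letter \<pi> = w" "follows A s' \<pi>"
      using ex_follows[OF assms(3) s'(1) history_Nil w] by auto
    have "\<pi> \<in> seqs V UNIV"
      using w \<pi>(1) seqs_iff seqs_UNIV_map by metis
    then have "aut_value V A w \<le> run_value V \<pi>"
      using winning_follows_dominates[OF assms(3) s'(1) win \<pi>(2)] by (simp add: dominates_def \<pi>(1))
    also have "\<dots> \<le> aut_value V B w"
      using run_value_le_aut_value[OF follows_run[OF \<pi>(2) s'(2)]] by (simp add: \<pi>(1))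
    finally show "aut_value V A w \<le> aut_value V B w" .
  qed
  then have "equivalent V A B"
    by (simp add: equivalent_def B_sel)
  then show ?thesis
    using autB detB prunes unfolding determinizable_by_pruning_def prunes_def by blast
qed

theorem theorem19:
  fixes V :: value_fun and A :: "('a, 'q) qaut"
  assumes "present_focused V" and "suffix_monotonic V" and "automaton A"
  shows "history_deterministic V A \<longleftrightarrow> determinizable_by_pruning V A"
  using history_deterministic_imp_prunable[OF assms] prunable_imp_history_deterministic[OF assms(3)]
  by blast

end
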